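(* Let $\ell\ge 3$ and let $C_{n,\ell}(x)$ denote the independence polynomial of the uniform linear hypercomb $C_{n,\ell}$ for $n\ge 1$, and set $C_{0,\ell}(x)=1+\ell x$. Then $$C_{1,\ell}(x)=1+(3\ell-2)x+\bigl(2(\ell-1)(\ell-2)+(\ell-1)^2+2(\ell-1)\bigr)x^2+(\ell-1)^2(\ell-2)x^3,$$ and for all $n\ge 2$, $$C_{n,\ell}(x)=(1+(\ell-1)x)\bigl((1+(\ell-2)x)C_{n-1,\ell}(x)+xC_{n-2,\ell}(x)\bigr).$$
   Context: A (strong) independent set in a hypergraph is a set of vertices containing at most one vertex from each edge; the independence polynomial of a hypergraph is $\sum_{k\ge0} i_k x^k$ where $i_k$ is the number of independent sets of size $k$. For $n\ge1$, $\ell\ge2$, $P_{n,\ell}$ is the linear hyperpath with edges $e_1,\ldots,e_n$ each of size $\ell$, with $e_i\cap e_{i+1}$ a single vertex for $i<n$ and no other pairs of edges intersecting. The uniform linear hypercomb $C_{n,\ell}$ ($n\ge1$) is obtained from $P_{n,\ell}$ by adding: for each vertex $v$ lying in two edges of $P_{n,\ell}$, a new edge of size $\ell$ consisting of $v$ and $\ell-1$ new vertices; and, for one vertex $w$ of $e_1$ lying in no other edge and one vertex $w'$ of $e_n$ lying in no other edge (with $w\ne w'$, enforced when $n=1$), a new edge of size $\ell$ consisting of $w$ and $\ell-1$ new vertices and a new edge of size $\ell$ consisting of $w'$ and $\ell-1$ new vertices. All new vertices are distinct from each other and from those of $P_{n,\ell}$. *)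

theory Defs
  imports "HOL-Computational_Algebra.Polynomial"
begin

record 'a hypergraph =
  verts :: "'a set"
  edges :: "'a set set"

definition indep_set :: "'a hypergraph \<Rightarrow> 'a set \<Rightarrow> bool" where
  "indep_set H S \<longleftrightarrow> S \<subseteq> verts H \<and> (\<forall>e\<in>edges H. \<exists>\<^sub>\<le>\<^sub>1 v. v \<in> S \<inter> e)"

(* For hypergraphs with finitely many vertices; then the number of independent sets of
   size k vanishes for k > card (verts H), so the finite sum is the full sum over k. *)
definition indep_poly :: "'a hypergraph \<Rightarrow> int poly" where
  "indep_poly H = (\<Sum>k\<le>card (verts H). monom (int (card {S. indep_set H S \<and> card S = k})) k)"

(* The edges of the path are e 1, ..., e n; the values of e at other indices are irrelevant. *)
definition linear_hyperpath_edges :: "nat \<Rightarrow> nat \<Rightarrow> (nat \<Rightarrow> 'a set) \<Rightarrow> bool" where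
  "linear_hyperpath_edges n l e \<longleftrightarrow>
     (\<forall>i\<in>{1..n}. finite (e i) \<and> card (e i) = l) \<and>
     (\<forall>i. 1 \<le> i \<and> i < n \<longrightarrow> card (e i \<inter> e (i + 1)) = 1) \<and>
     (\<forall>i j. 1 \<le> i \<and> i + 1 < j \<and> j \<le> n \<longrightarrow> e i \<inter> e j = {})"

definition linear_hyperpath :: "nat \<Rightarrow> (nat \<Rightarrow> 'a set) \<Rightarrow> 'a hypergraph" where
  "linear_hyperpath n e = \<lparr>verts = (\<Union>i\<in>{1..n}. e i), edges = e ` {1..n}\<rparr>"

definition joint_vertices :: "nat \<Rightarrow> (nat \<Rightarrow> 'a set) \<Rightarrow> 'a set" where
  "joint_vertices n e = {v. \<exists>i\<in>{1..n}. \<exists>j\<in>{1..n}. i \<noteq> j \<and> v \<in> e i \<and> v \<in> e j}"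

(* H is a copy of the hypercomb, which is determined only up to isomorphism: f v is the new
   edge attached at v. Disjointness of distinct new edges says that the new vertices
   are pairwise distinct across edges (the attaching vertices differ anyway). *)
definition is_hypercomb :: "nat \<Rightarrow> nat \<Rightarrow> 'a hypergraph \<Rightarrow> bool" where
  "is_hypercomb n l H \<longleftrightarrow>
     (\<exists>e w w' f A P.
        linear_hyperpath_edges n l e \<and> P = linear_hyperpath n e \<and>
        w \<in> e 1 \<and> (\<forall>i\<in>{1..n}. i \<noteq> 1 \<longrightarrow> w \<notin> e i) \<and>
        w' \<in> e n \<and> (\<forall>i\<in>{1..n}. i \<noteq> n \<longrightarrow> w' \<notin> e i) \<and>
        w \<noteq> w' \<and>
        A = joint_vertices n e \<union> {w, w'} \<and>
        (\<forall>v\<in>A. finite (f v) \<and> card (f v) = l \<and> f v \<inter> verts P = {v}) \<and>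
        (\<forall>u\<in>A. \<forall>v\<in>A. u \<noteq> v \<longrightarrow> f u \<inter> f v = {}) \<and>
        verts H = verts P \<union> (\<Union>v\<in>A. f v) \<and>
        edges H = edges P \<union> f ` A)"

lemma ex_hypercomb:
  assumes "n \<ge> 1" and "l \<ge> 2"
  shows "\<exists>H :: (nat \<times> nat) hypergraph. is_hypercomb n l H"
proof -
  define e :: "nat \<Rightarrow> (nat \<times> nat) set" where
    "e = (\<lambda>i. insert (i - 1, 0) ({i} \<times> {..<l - 1}))"
  define f :: "nat \<times> nat \<Rightarrow> (nat \<times> nat) set" where
    "f = (\<lambda>v. insert v ({fst v} \<times> {l..<2 * l - 1}))"
  define P where "P = linear_hyperpath n e"
  define A where "A = joint_vertices n e \<union> {(0, 0), (n, 0)}"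
  have path: "linear_hyperpath_edges n l e"
  proof -
    have "finite (e i) \<and> card (e i) = l" if "i \<in> {1..n}" for i
      using that assms by (auto simp: e_def card_insert_if card_cartesian_product)
    moreover have "card (e i \<inter> e (i + 1)) = 1" if "1 \<le> i" for i
    proof -
      have "e i \<inter> e (i + 1) = {(i, 0)}" using that assms by (auto simp: e_def)
      then show ?thesis by simp
    qed
    moreover have "e i \<inter> e j = {}" if "1 \<le> i" "i + 1 < j" for i j
      using that by (auto simp: e_def)
    ultimately show ?thesis unfolding linear_hyperpath_edges_def by blast
  qed
  have A: "v \<in> {..n} \<times> {0}" if "v \<in> A" for v
    using that by (auto simp: A_def joint_vertices_def e_def)
  have vA: "v \<in> verts P" if "v \<in> A" for v
    using that assms by (force simp: A_def joint_vertices_def P_def linear_hyperpath_def e_def)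
  have attach: "finite (f v) \<and> card (f v) = l \<and> f v \<inter> verts P = {v}" if "v \<in> A" for v
    using A[OF that] vA[OF that] assms
    by (auto simp: f_def card_insert_if card_cartesian_product P_def linear_hyperpath_def e_def)
  have disj: "f u \<inter> f v = {}" if "u \<in> A" "v \<in> A" "u \<noteq> v" for u v
    using A[OF that(1)] A[OF that(2)] that(3) assms by (auto simp: f_def)
  have w: "(0, 0) \<in> e 1" "\<forall>i\<in>{1..n}. i \<noteq> 1 \<longrightarrow> (0, 0) \<notin> e i"
    "(n, 0) \<in> e n" "\<forall>i\<in>{1..n}. i \<noteq> n \<longrightarrow> (n, 0) \<notin> e i" "(0::nat, 0::nat) \<noteq> (n, 0)"
    using assms by (auto simp: e_def)
  have "is_hypercomb n l \<lparr>verts = verts P \<union> (\<Union>v\<in>A. f v), edges = edges P \<union> f ` A\<rparr>"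
    unfolding is_hypercomb_def
    by (rule exI[of _ e], rule exI[of _ "(0, 0)"], rule exI[of _ "(n, 0)"], rule exI[of _ f],
        rule exI[of _ A], rule exI[of _ P])
      (use path w attach disj P_def A_def in simp)
  then show ?thesis by blast
qed

end

theory Submission
  imports Defs
begin

text \<open>
  Let \<open>v\<^sub>0 = w, v\<^sub>1, \<dots>, v\<^sub>n = w'\<close> be the attaching vertices, \<open>v\<^sub>i\<close> being the common vertex
  of \<open>e\<^sub>i\<close> and \<open>e\<^sub>i\<^sub>+\<^sub>1\<close>. Write \<open>q = 1 + (l - 1) x\<close> and \<open>r = 1 + (l - 2) x\<close>, and count the independent
  sets of the part of the comb up to \<open>v\<^sub>k\<close> by two polynomials, \<open>a\<^sub>k\<close> for those avoiding \<open>v\<^sub>k\<close> and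
  \<open>b\<^sub>k\<close> for those containing it. Then \<open>a\<^sub>0 = q\<close>, \<open>b\<^sub>0 = x\<close>, \<open>a\<^sub>k\<^sub>+\<^sub>1 = q (r a\<^sub>k + b\<^sub>k)\<close> and
  \<open>b\<^sub>k\<^sub>+\<^sub>1 = x a\<^sub>k\<close>, and the recurrence for \<open>a\<^sub>n + b\<^sub>n\<close> is elementary algebra.
\<close>

section \<open>Generating functions of set families\<close>

text \<open>Summing over members instead of sizes turns disjoint unions into sums and unions over
  disjoint supports into products. An infinite family gets the value 0, hence the finiteness
  conditions below.\<close>

definition size_gf :: "'a set set \<Rightarrow> int poly" where
  "size_gf F = (\<Sum>S\<in>F. monom 1 (card S))"

lemma size_gf_Un:
  assumes "finite F" "finite G" "F \<inter> G = {}"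
  shows "size_gf (F \<union> G) = size_gf F + size_gf G"
  using assms by (simp add: size_gf_def sum.union_disjoint)

definition join :: "'a set set \<Rightarrow> 'a set set \<Rightarrow> 'a set set" where
  "join F G = (\<lambda>(S, T). S \<union> T) ` (F \<times> G)"

text \<open>Disjoint supports allow both parts to be recovered from the union by intersecting with
  \<open>X\<close> and \<open>Y\<close>, so no union arises twice, and cardinalities add.\<close>

lemma size_gf_join:
  assumes "F \<subseteq> Pow X" "G \<subseteq> Pow Y" "X \<inter> Y = {}" "finite X" "finite Y"
  shows "size_gf (join F G) = size_gf F * size_gf G"
proof -
  have inj: "inj_on (\<lambda>(S, T). S \<union> T) (F \<times> G)"
  proof (rule inj_onI, clarify)
    fix S T S' T'
    assume *: "S \<in> F" "T \<in> G" "S' \<in> F" "T' \<in> G" and eq: "S \<union> T = S' \<union> T'"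
    have "S = (S \<union> T) \<inter> X" "S' = (S' \<union> T') \<inter> X" "T = (S \<union> T) \<inter> Y" "T' = (S' \<union> T') \<inter> Y"
      using * assms(1-3) by blast+
    with eq show "S = S' \<and> T = T'" by metis
  qed
  have "card (S \<union> T) = card S + card T" if "S \<in> F" "T \<in> G" for S T
  proof (rule card_Un_disjoint)
    have "S \<subseteq> X" "T \<subseteq> Y" using that assms(1,2) by auto
    then show "finite S" "finite T" "S \<inter> T = {}"
      using assms(3-5) by (auto dest: finite_subset)
  qed
  then have "size_gf (join F G) = (\<Sum>(S, T)\<in>F \<times> G. monom 1 (card S) * monom 1 (card T))"
    unfolding size_gf_def join_def
    by (subst sum.reindex[OF inj]) (auto intro!: sum.cong simp: mult_monom)
  also have "\<dots> = size_gf F * size_gf G"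
    by (simp add: size_gf_def sum_product sum.cartesian_product)
  finally show ?thesis .
qed

text \<open>The possible traces of an independent set on vertices that share an edge.\<close>

definition small_subsets :: "'a set \<Rightarrow> 'a set set" where
  "small_subsets Z = {T. T \<subseteq> Z \<and> (\<exists>\<^sub>\<le>\<^sub>1 v. v \<in> T)}"

lemma small_subsets_eq: "small_subsets Z = insert {} ((\<lambda>z. {z}) ` Z)"
  unfolding small_subsets_def Uniq_def by blast

lemma size_gf_small_subsets:
  assumes "finite Z"
  shows "size_gf (small_subsets Z) = [:1, int (card Z):]"
proof -
  have "size_gf (small_subsets Z) = 1 + of_nat (card Z) * monom 1 1"
    using assms unfolding small_subsets_eq size_gf_def
    by (subst sum.insert) (auto simp: sum.reindex)
  then show ?thesis by (simp add: monom_altdef of_nat_poly one_pCons)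
qed

lemma small_subsets_subset: "small_subsets Z \<subseteq> Pow Z"
  by (auto simp: small_subsets_def)

lemma join_subset: "F \<subseteq> Pow X \<Longrightarrow> G \<subseteq> Pow Y \<Longrightarrow> join F G \<subseteq> Pow (X \<union> Y)"
  by (fastforce simp: join_def)

lemma size_gf_singleton: "size_gf {{u}} = [:0, 1:]"
  by (simp add: size_gf_def monom_altdef)

text \<open>Grouping the members by cardinality recovers the sum over \<open>k\<close>; no
  independent set is larger than the vertex set.\<close>

lemma indep_poly_eq_size_gf:
  assumes "finite (verts H)"
  shows "indep_poly H = size_gf {S. indep_set H S}"
proof -
  let ?F = "{S. indep_set H S}"
  have sub: "?F \<subseteq> Pow (verts H)" by (auto simp: indep_set_def)
  then have fin: "finite ?F" by (rule finite_subset) (use assms in simp)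
  have "indep_poly H = (\<Sum>k\<le>card (verts H). \<Sum>S\<in>{S\<in>?F. card S = k}. monom 1 (card S))"
    unfolding indep_poly_def
  proof (rule sum.cong[OF refl])
    fix k
    have "(\<Sum>S\<in>{S\<in>?F. card S = k}. monom 1 (card S)) =
      (\<Sum>S\<in>{S\<in>?F. card S = k}. (monom 1 k :: int poly))"
      by (rule sum.cong) auto
    also have "\<dots> = monom (int (card {S. indep_set H S \<and> card S = k})) k"
      by (simp add: of_nat_poly smult_monom)
    finally show "monom (int (card {S. indep_set H S \<and> card S = k})) k =
      (\<Sum>S\<in>{S\<in>?F. card S = k}. monom 1 (card S))" by simp
  qed
  also have "\<dots> = size_gf ?F"
    unfolding size_gf_def using sub assms
    by (intro sum.group fin) (auto intro: card_mono)
  finally show ?thesis .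
qed

section \<open>The transfer recursion along the comb\<close>

text \<open>These are the polynomials for an avoided and a contained last attaching vertex. The
  parameter is an integer so that \<open>l - 1\<close> and \<open>l - 2\<close> are not
  truncated.\<close>

fun free_poly :: "int \<Rightarrow> nat \<Rightarrow> int poly" and occ_poly :: "int \<Rightarrow> nat \<Rightarrow> int poly" where
  "free_poly l 0 = [:1, l - 1:]"
| "free_poly l (Suc k) = [:1, l - 1:] * ([:1, l - 2:] * free_poly l k + occ_poly l k)"
| "occ_poly l 0 = [:0, 1:]"
| "occ_poly l (Suc k) = [:0, 1:] * free_poly l k"

text \<open>
  \<open>p i\<close> is the set of the remaining vertices of the path edge through \<open>v i\<close> and \<open>v (Suc i)\<close>
  (the edge \<open>e\<^sub>i\<^sub>+\<^sub>1\<close> of the paper), and \<open>g i\<close> the set of new vertices of the edge attached at \<open>v i\<close>.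
\<close>

locale comb =
  fixes n l :: nat and v :: "nat \<Rightarrow> 'a" and p g :: "nat \<Rightarrow> 'a set"
  assumes l: "l \<ge> 2"
    and v_inj: "\<lbrakk>i \<le> n; j \<le> n; v i = v j\<rbrakk> \<Longrightarrow> i = j"
    and v_p: "\<lbrakk>i \<le> n; j < n\<rbrakk> \<Longrightarrow> v i \<notin> p j"
    and v_g: "\<lbrakk>i \<le> n; j \<le> n\<rbrakk> \<Longrightarrow> v i \<notin> g j"
    and p_p: "\<lbrakk>i < n; j < n; i \<noteq> j\<rbrakk> \<Longrightarrow> p i \<inter> p j = {}"
    and g_g: "\<lbrakk>i \<le> n; j \<le> n; i \<noteq> j\<rbrakk> \<Longrightarrow> g i \<inter> g j = {}"
    and p_g: "\<lbrakk>i < n; j \<le> n\<rbrakk> \<Longrightarrow> p i \<inter> g j = {}"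
    and p_fin: "i < n \<Longrightarrow> finite (p i)" and p_card: "i < n \<Longrightarrow> card (p i) = l - 2"
    and g_fin: "i \<le> n \<Longrightarrow> finite (g i)" and g_card: "i \<le> n \<Longrightarrow> card (g i) = l - 1"
begin

definition path_edge :: "nat \<Rightarrow> 'a set" where
  "path_edge i = insert (v i) (insert (v (Suc i)) (p i))"

definition tooth :: "nat \<Rightarrow> 'a set" where
  "tooth i = insert (v i) (g i)"

text \<open>The truncated comb ends with the complete tooth at \<open>v k\<close>, so each step adds
  one path edge and one tooth; \<open>V 0\<close> is a single tooth.\<close>

definition V :: "nat \<Rightarrow> 'a set" where
  "V k = (\<Union>i<k. path_edge i) \<union> (\<Union>i\<le>k. tooth i)"

definition I :: "nat \<Rightarrow> 'a set set" where
  "I k = {S. S \<subseteq> V k \<and> (\<forall>i<k. \<exists>\<^sub>\<le>\<^sub>1 u. u \<in> S \<inter> path_edge i) \<and> (\<forall>i\<le>k. \<exists>\<^sub>\<le>\<^sub>1 u. u \<in> S \<inter> tooth i)}"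

text \<open>The next path edge meets \<open>V k\<close> only in \<open>v k\<close>, so whether
  \<open>v k\<close> is chosen is all that the next step needs to know.\<close>

definition free_sets :: "nat \<Rightarrow> 'a set set" where
  "free_sets k = {S \<in> I k. v k \<notin> S}"

definition occ_sets :: "nat \<Rightarrow> 'a set set" where
  "occ_sets k = {S \<in> I k. v k \<in> S}"

section \<open>Growth of the vertex sets of the truncated combs\<close>

lemma finite_V: "k \<le> n \<Longrightarrow> finite (V k)"
  by (auto simp: V_def path_edge_def tooth_def p_fin g_fin)

lemma V_Suc: "V (Suc k) = V k \<union> insert (v (Suc k)) (p k \<union> g (Suc k))"
  by (auto simp: V_def path_edge_def tooth_def lessThan_Suc atMost_Suc)

lemma v_in_V: "v k \<in> V k"
  by (auto simp: V_def tooth_def)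

lemma V_mem: "u \<in> V k \<longleftrightarrow> (\<exists>i\<le>k. u = v i) \<or> (\<exists>i<k. u \<in> p i) \<or> (\<exists>i\<le>k. u \<in> g i)"
  by (induction k) (auto simp: V_Suc le_Suc_eq less_Suc_eq, auto simp: V_def tooth_def)

text \<open>Freshness of everything added at step \<open>k\<close>: this supplies the disjoint
  supports for the product rule.\<close>

lemma V_new:
  assumes "k < n"
  shows "v (Suc k) \<notin> V k" "V k \<inter> p k = {}" "V k \<inter> g (Suc k) = {}"
proof -
  have "v (Suc k) \<noteq> v i" if "i \<le> k" for i
    using v_inj[of "Suc k" i] that assms by auto
  then show "v (Suc k) \<notin> V k"
    using assms by (auto simp: V_mem v_p v_g)
  have "u \<notin> p k" if "u \<in> p i" "i < k" for u i
    using p_p[of i k] that assms by auto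
  moreover have "u \<notin> p k" if "u \<in> g i" "i \<le> k" for u i
    using p_g[of k i] that assms by auto
  ultimately show "V k \<inter> p k = {}"
    using assms by (auto simp: V_mem v_p)
  have "u \<notin> g (Suc k)" if "u \<in> g i" "i \<le> k" for u i
    using g_g[of i "Suc k"] that assms by auto
  moreover have "u \<notin> g (Suc k)" if "u \<in> p i" "i < k" for u i
    using p_g[of i "Suc k"] that assms by auto
  ultimately show "V k \<inter> g (Suc k) = {}"
    using assms by (auto simp: V_mem v_g)
qed

text \<open>Old edges lie inside \<open>V k\<close>, so their constraints see only
  \<open>S \<inter> V k\<close>; what remains are the constraints of the two new edges.\<close>

lemma I_Suc:
  "S \<in> I (Suc k) \<longleftrightarrow> S \<subseteq> V (Suc k) \<and> S \<inter> V k \<in> I k \<and>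
     (\<exists>\<^sub>\<le>\<^sub>1 u. u \<in> S \<inter> path_edge k) \<and> (\<exists>\<^sub>\<le>\<^sub>1 u. u \<in> S \<inter> tooth (Suc k))"
proof -
  have "S \<inter> V k \<inter> path_edge i = S \<inter> path_edge i" if "i < k" for i
    using that by (auto simp: V_def)
  moreover have "S \<inter> V k \<inter> tooth i = S \<inter> tooth i" if "i \<le> k" for i
    using that by (auto simp: V_def)
  ultimately show ?thesis
    unfolding I_def by (auto simp only: mem_Collect_eq less_Suc_eq le_Suc_eq)
qed

text \<open>Among the new edges, the tooth misses \<open>V k\<close> and the path edge meets it in
  \<open>v k\<close> alone. Hence the old part \<open>A\<close> restricts the new part
  \<open>R\<close> only through the membership of \<open>v k\<close>.\<close>

lemma I_Suc_Un:
  assumes k: "k < n" and A: "A \<subseteq> V k" and R: "R \<subseteq> insert (v (Suc k)) (p k \<union> g (Suc k))"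
  shows "A \<union> R \<in> I (Suc k) \<longleftrightarrow> A \<in> I k \<and>
    (\<exists>\<^sub>\<le>\<^sub>1 u. u \<in> A \<inter> {v k} \<union> R \<inter> insert (v (Suc k)) (p k)) \<and>
    (\<exists>\<^sub>\<le>\<^sub>1 u. u \<in> R \<inter> insert (v (Suc k)) (g (Suc k)))"
proof -
  note new = V_new[OF k]
  have RV: "R \<inter> V k = {}"
    using R new by auto
  then have vk: "v k \<notin> R"
    using v_in_V[of k] by auto
  have "(A \<union> R) \<inter> V k = A"
    using A RV by auto
  moreover have "(A \<union> R) \<inter> path_edge k = A \<inter> {v k} \<union> R \<inter> insert (v (Suc k)) (p k)"
    using A new vk by (auto simp: path_edge_def)
  moreover have "(A \<union> R) \<inter> tooth (Suc k) = R \<inter> insert (v (Suc k)) (g (Suc k))"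
    using A new by (auto simp: tooth_def)
  moreover have "A \<union> R \<subseteq> V (Suc k)"
    using A R by (auto simp: V_Suc)
  ultimately show ?thesis by (simp add: I_Suc)
qed

lemma I_SucE:
  assumes "S \<in> I (Suc k)"
  obtains A R where "S = A \<union> R" "A \<subseteq> V k" "R \<subseteq> insert (v (Suc k)) (p k \<union> g (Suc k))"
proof -
  have "S = (S \<inter> V k) \<union> (S \<inter> insert (v (Suc k)) (p k \<union> g (Suc k)))"
    using assms by (auto simp: I_def V_Suc)
  then show ?thesis by (rule that) auto
qed

section \<open>Decomposition by the state of the last attaching vertex\<close>

lemma I_subset: "S \<in> I k \<Longrightarrow> S \<subseteq> V k"
  by (simp add: I_def)

text \<open>With \<open>v (Suc k)\<close> avoided, the new tooth contributes freely from
  \<open>g (Suc k)\<close>. The path edge contributes from \<open>p k\<close> if \<open>v k\<close>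
  is avoided, and nothing more if \<open>v k\<close> is chosen.\<close>

lemma free_sets_Suc:
  assumes k: "k < n"
  shows "free_sets (Suc k) =
    join (free_sets k) (join (small_subsets (p k)) (small_subsets (g (Suc k)))) \<union>
    join (occ_sets k) (small_subsets (g (Suc k)))"
proof -
  note new = V_new[OF k]
  have vp: "v (Suc k) \<notin> p k" and vg: "v (Suc k) \<notin> g (Suc k)" and pg: "p k \<inter> g (Suc k) = {}"
    using k by (simp_all add: v_p v_g p_g)
  show ?thesis
  proof (intro equalityI subsetI)
    fix S assume S: "S \<in> free_sets (Suc k)"
    then have "S \<in> I (Suc k)" by (simp add: free_sets_def)
    then obtain A R where AR: "S = A \<union> R" "A \<subseteq> V k"
        "R \<subseteq> insert (v (Suc k)) (p k \<union> g (Suc k))"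
      by (rule I_SucE)
    have vS: "v (Suc k) \<notin> R"
      using S AR(1) by (auto simp: free_sets_def)
    have I: "A \<in> I k" "\<exists>\<^sub>\<le>\<^sub>1 u. u \<in> A \<inter> {v k} \<union> R \<inter> p k" "\<exists>\<^sub>\<le>\<^sub>1 u. u \<in> R \<inter> g (Suc k)"
      using S I_Suc_Un[OF k AR(2,3)] vS by (simp_all add: free_sets_def AR(1))
    have U: "R \<inter> g (Suc k) \<in> small_subsets (g (Suc k))"
      using I(3) by (simp add: small_subsets_def)
    have R: "R = R \<inter> p k \<union> R \<inter> g (Suc k)"
      using AR(3) vS by blast
    show "S \<in> join (free_sets k) (join (small_subsets (p k)) (small_subsets (g (Suc k)))) \<union>
      join (occ_sets k) (small_subsets (g (Suc k)))"
    proof (cases "v k \<in> A")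
      case True
      \<comment> \<open>An element here would be a second chosen vertex of the path edge, distinct
        from \<open>v k\<close> because \<open>p k\<close> misses \<open>V k\<close>.\<close>
      have "R \<inter> p k = {}"
        using I(2) True new(2) AR(2) by (force simp: Uniq_def)
      then have "S = A \<union> R \<inter> g (Suc k)" using AR(1) R by blast
      moreover have "A \<in> occ_sets k" using True I(1) by (simp add: occ_sets_def)
      ultimately show ?thesis using U by (auto simp: join_def)
    next
      case False
      have "R \<inter> p k \<in> small_subsets (p k)"
        using I(2) False by (simp add: small_subsets_def)
      with U R have "R \<in> join (small_subsets (p k)) (small_subsets (g (Suc k)))"
        unfolding join_def by (intro image_eqI[of _ _ "(R \<inter> p k, R \<inter> g (Suc k))"]) auto
      moreover have "A \<in> free_sets k" using False I(1) by (simp add: free_sets_def)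
      ultimately show ?thesis using AR(1) by (auto simp: join_def)
    qed
  next
    fix S
    assume "S \<in> join (free_sets k) (join (small_subsets (p k)) (small_subsets (g (Suc k)))) \<union>
      join (occ_sets k) (small_subsets (g (Suc k)))"
    then consider A T U where "S = A \<union> (T \<union> U)" "A \<in> free_sets k"
        "T \<in> small_subsets (p k)" "U \<in> small_subsets (g (Suc k))"
      | A U where "S = A \<union> U" "A \<in> occ_sets k" "U \<in> small_subsets (g (Suc k))"
      by (auto simp: join_def)
    then show "S \<in> free_sets (Suc k)"
    proof cases
      case 1
      then have A: "A \<in> I k" "v k \<notin> A" and T: "T \<subseteq> p k" "\<exists>\<^sub>\<le>\<^sub>1 u. u \<in> T"
        and U: "U \<subseteq> g (Suc k)" "\<exists>\<^sub>\<le>\<^sub>1 u. u \<in> U"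
        by (auto simp: free_sets_def small_subsets_def)
      have "A \<inter> {v k} \<union> (T \<union> U) \<inter> insert (v (Suc k)) (p k) = T"
        "(T \<union> U) \<inter> insert (v (Suc k)) (g (Suc k)) = U"
        using A(2) T(1) U(1) vp vg pg by auto
      moreover have "T \<union> U \<subseteq> insert (v (Suc k)) (p k \<union> g (Suc k))"
        using T(1) U(1) by blast
      ultimately have "S \<in> I (Suc k)"
        using A T U I_Suc_Un[OF k I_subset[OF A(1)], of "T \<union> U"] by (simp add: 1(1))
      moreover have "v (Suc k) \<notin> S"
        using I_subset[OF A(1)] new(1) T(1) U(1) vp vg by (auto simp: 1(1))
      ultimately show ?thesis by (simp add: free_sets_def)
    next
      case 2
      then have A: "A \<in> I k" "v k \<in> A" and U: "U \<subseteq> g (Suc k)" "\<exists>\<^sub>\<le>\<^sub>1 u. u \<in> U"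
        by (auto simp: occ_sets_def small_subsets_def)
      have "A \<inter> {v k} = {v k}" "U \<inter> insert (v (Suc k)) (p k) = {}"
        "U \<inter> insert (v (Suc k)) (g (Suc k)) = U"
        using A(2) U(1) vg pg by auto
      moreover have "U \<subseteq> insert (v (Suc k)) (p k \<union> g (Suc k))"
        using U(1) by blast
      ultimately have "S \<in> I (Suc k)"
        using A U I_Suc_Un[OF k I_subset[OF A(1)], of U] by (simp add: 2(1) Uniq_def)
      moreover have "v (Suc k) \<notin> S"
        using I_subset[OF A(1)] new(1) U(1) vg by (auto simp: 2(1))
      ultimately show ?thesis by (simp add: free_sets_def)
    qed
  qed
qed

text \<open>The vertex \<open>v (Suc k)\<close> lies on both new edges, so choosing it rules out
  \<open>v k\<close>, all of \<open>p k\<close> and all of \<open>g (Suc k)\<close>.\<close>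

lemma occ_sets_Suc:
  assumes k: "k < n"
  shows "occ_sets (Suc k) = join (free_sets k) {{v (Suc k)}}"
proof -
  note new = V_new[OF k]
  show ?thesis
  proof (intro equalityI subsetI)
    fix S assume S: "S \<in> occ_sets (Suc k)"
    then have "S \<in> I (Suc k)" by (simp add: occ_sets_def)
    then obtain A R where AR: "S = A \<union> R" "A \<subseteq> V k"
        "R \<subseteq> insert (v (Suc k)) (p k \<union> g (Suc k))"
      by (rule I_SucE)
    have vR: "v (Suc k) \<in> R"
      using S AR(1,2) new(1) by (auto simp: occ_sets_def)
    have I: "A \<in> I k" "\<exists>\<^sub>\<le>\<^sub>1 u. u \<in> A \<inter> {v k} \<union> R \<inter> insert (v (Suc k)) (p k)"
        "\<exists>\<^sub>\<le>\<^sub>1 u. u \<in> R \<inter> insert (v (Suc k)) (g (Suc k))"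
      using S I_Suc_Un[OF k AR(2,3)] by (simp_all add: occ_sets_def AR(1))
    have "R = {v (Suc k)}"
    proof -
      have "u = v (Suc k)" if "u \<in> R" for u
        using that AR(3) vR I(2,3) unfolding Uniq_def by blast
      then show ?thesis using vR by blast
    qed
    moreover have "v k \<notin> A"
      using I(2) vR new(1) v_in_V[of k] unfolding Uniq_def by (metis IntI UnI1 UnI2 insertI1)
    ultimately show "S \<in> join (free_sets k) {{v (Suc k)}}"
      using I(1) AR(1) by (auto simp: join_def free_sets_def)
  next
    fix S assume "S \<in> join (free_sets k) {{v (Suc k)}}"
    then obtain A where A: "S = A \<union> {v (Suc k)}" "A \<in> I k" "v k \<notin> A"
      by (auto simp: join_def free_sets_def)
    then show "S \<in> occ_sets (Suc k)"
      using I_Suc_Un[OF k I_subset[OF A(2)], of "{v (Suc k)}"]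
      by (auto simp: occ_sets_def Uniq_def)
  qed
qed

section \<open>From decompositions of families to polynomial recursions\<close>

lemma free_sets_subset: "free_sets k \<subseteq> Pow (V k)" and occ_sets_subset: "occ_sets k \<subseteq> Pow (V k)"
  by (auto simp: free_sets_def occ_sets_def I_def)

lemma size_gf_p: "i < n \<Longrightarrow> size_gf (small_subsets (p i)) = [:1, int l - 2:]"
  using l by (simp add: size_gf_small_subsets p_fin p_card of_nat_diff)

lemma size_gf_g: "i \<le> n \<Longrightarrow> size_gf (small_subsets (g i)) = [:1, int l - 1:]"
  using l by (simp add: size_gf_small_subsets g_fin g_card of_nat_diff)

lemma size_gf_sets:
  assumes "k \<le> n"
  shows "size_gf (free_sets k) = free_poly (int l) k \<and> size_gf (occ_sets k) = occ_poly (int l) k"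
  using assms
proof (induction k)
  case 0
  have vg: "v 0 \<notin> g 0" by (simp add: v_g)
  have "free_sets 0 = small_subsets (g 0)"
    using vg by (auto simp: free_sets_def I_def V_def tooth_def small_subsets_def Uniq_def)
  moreover have "occ_sets 0 = {{v 0}}"
    by (auto simp: occ_sets_def I_def V_def tooth_def Uniq_def)
  ultimately show ?case by (simp add: size_gf_g size_gf_singleton)
next
  case (Suc k)
  then have k: "k < n" by simp
  note new = V_new[OF k]
  let ?P = "small_subsets (p k)" and ?G = "small_subsets (g (Suc k))"
  have fin: "finite (V k)" "finite (p k)" "finite (g (Suc k))"
    using k by (auto simp: finite_V p_fin g_fin)
  have pg: "p k \<inter> g (Suc k) = {}" using k by (simp add: p_g)
  have PG: "join ?P ?G \<subseteq> Pow (p k \<union> g (Suc k))"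
    by (intro join_subset small_subsets_subset)
  have VPG: "V k \<inter> (p k \<union> g (Suc k)) = {}" using new by blast
  have finj: "finite (join (free_sets k) (join ?P ?G))" "finite (join (occ_sets k) ?G)"
    using join_subset[OF free_sets_subset PG, of k]
      join_subset[OF occ_sets_subset small_subsets_subset, of k "g (Suc k)"] fin
    by (auto elim!: finite_subset)
  \<comment> \<open>Membership of \<open>v k\<close> tells the two families in the decomposition
    apart.\<close>
  have "v k \<notin> S" if "S \<in> join (free_sets k) (join ?P ?G)" for S
    using that PG VPG v_in_V[of k] by (fastforce simp: join_def free_sets_def)
  moreover have "v k \<in> S" if "S \<in> join (occ_sets k) ?G" for S
    using that by (auto simp: join_def occ_sets_def)
  ultimately have disj: "join (free_sets k) (join ?P ?G) \<inter> join (occ_sets k) ?G = {}"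
    by blast
  have "size_gf (free_sets (Suc k)) =
      size_gf (free_sets k) * (size_gf ?P * size_gf ?G) + size_gf (occ_sets k) * size_gf ?G"
    unfolding free_sets_Suc[OF k] size_gf_Un[OF finj disj]
    using size_gf_join[OF free_sets_subset PG VPG] 
      size_gf_join[OF small_subsets_subset small_subsets_subset pg]
      size_gf_join[OF occ_sets_subset small_subsets_subset new(3)] fin by simp
  also have "\<dots> = free_poly (int l) (Suc k)"
    using Suc k by (simp only: size_gf_p size_gf_g free_poly.simps Suc_leI less_imp_le ring_distribs mult_ac)
  finally have "size_gf (free_sets (Suc k)) = free_poly (int l) (Suc k)" .
  moreover have "size_gf (occ_sets (Suc k)) = size_gf (free_sets k) * size_gf {{v (Suc k)}}"
    unfolding occ_sets_Suc[OF k]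
    by (rule size_gf_join[OF free_sets_subset, of _ "{v (Suc k)}"]) (use new fin in auto)
  moreover have "\<dots> = occ_poly (int l) (Suc k)"
    using Suc by (simp add: size_gf_singleton mult.commute)
  ultimately show ?case by simp
qed

lemma size_gf_I: "size_gf (I n) = free_poly (int l) n + occ_poly (int l) n"
proof -
  have "I n = free_sets n \<union> occ_sets n" by (auto simp: free_sets_def occ_sets_def)
  moreover have "free_sets n \<inter> occ_sets n = {}" by (auto simp: free_sets_def occ_sets_def)
  moreover have "finite (free_sets n)" "finite (occ_sets n)"
    using free_sets_subset[of n] occ_sets_subset[of n] finite_V[of n]
    by (auto elim!: finite_subset)
  ultimately show ?thesis using size_gf_sets[of n] by (simp add: size_gf_Un)
qed

end

section \<open>Coordinates on a hypercomb\<close>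

text \<open>Any copy of the hypercomb is an instance of the locale \<open>comb\<close> once its
  attaching vertices are numbered along the path, so its polynomial depends only on \<open>n\<close>
  and \<open>l\<close>.\<close>

lemma indep_poly_hypercomb:
  assumes n: "n \<ge> 1" and H: "is_hypercomb n l H"
  shows "indep_poly H = free_poly (int l) n + occ_poly (int l) n"
proof -
  obtain e w w' f A P where path: "linear_hyperpath_edges n l e" and P: "P = linear_hyperpath n e"
    and w: "w \<in> e 1" "\<forall>i\<in>{1..n}. i \<noteq> 1 \<longrightarrow> w \<notin> e i"
    and w': "w' \<in> e n" "\<forall>i\<in>{1..n}. i \<noteq> n \<longrightarrow> w' \<notin> e i"
    and ww': "w \<noteq> w'"
    and A: "A = joint_vertices n e \<union> {w, w'}"
    and f: "\<forall>u\<in>A. finite (f u) \<and> card (f u) = l \<and> f u \<inter> verts P = {u}"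
    and ff: "\<forall>u\<in>A. \<forall>v\<in>A. u \<noteq> v \<longrightarrow> f u \<inter> f v = {}"
    and verts: "verts H = verts P \<union> (\<Union>v\<in>A. f v)"
    and edges: "edges H = edges P \<union> f ` A"
    using H unfolding is_hypercomb_def by (elim exE conjE) (rule that)
  have e_fin: "finite (e i)" "card (e i) = l" if "1 \<le> i" "i \<le> n" for i
    using path that by (auto simp: linear_hyperpath_edges_def)
  have e_far: "e i \<inter> e j = {}" if "1 \<le> i" "Suc i < j" "j \<le> n" for i j
    using path that by (auto simp: linear_hyperpath_edges_def)
  have "\<exists>u. e i \<inter> e (Suc i) = {u}" if "1 \<le> i" "i < n" for i
    using path that by (auto simp: linear_hyperpath_edges_def card_1_singleton_iff)
  then obtain c where c: "\<And>i. 1 \<le> i \<Longrightarrow> i < n \<Longrightarrow> e i \<inter> e (Suc i) = {c i}"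
    by metis
  \<comment> \<open>The joint vertices \<open>c i\<close> exist only for
    \<open>1 \<le> i < n\<close>; the chosen end vertices complete the sequence.\<close>
  define v where "v i = (if i = 0 then w else if i = n then w' else c i)" for i
  have v0: "v 0 = w" and vn: "v n = w'" and vc: "1 \<le> i \<Longrightarrow> i < n \<Longrightarrow> v i = c i" for i
    using n by (auto simp: v_def)
  have v_in: "v i \<in> e i" if "1 \<le> i" "i \<le> n" for i
    using that w'(1) c[of i] vn vc[of i] by (cases "i = n") auto
  have v_in': "v i \<in> e (Suc i)" if "i < n" for i
    using that w(1) c[of i] v0 vc[of i] by (cases "i = 0") auto
  have v_only: "i = j \<or> Suc i = j" if "i \<le> n" "1 \<le> j" "j \<le> n" "v i \<in> e j" for i j
  proof (rule ccontr)
    assume neq: "\<not> (i = j \<or> Suc i = j)"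
    consider "i = 0" | "i = n" | "1 \<le> i" "i < n" using \<open>i \<le> n\<close> by linarith
    then show False
    proof cases
      case 1
      then show ?thesis using w(2) that neq v0 by auto
    next
      case 2
      then show ?thesis using w'(2) that neq vn by auto
    next
      case 3
      \<comment> \<open>Both memberships matter: for \<open>j < i\<close> the edge
        \<open>e j\<close> may meet \<open>e i\<close> but not \<open>e (Suc i)\<close>, while for
        \<open>j > Suc i\<close> it misses \<open>e i\<close>.\<close>
      then have "v i \<in> e i" "v i \<in> e (Suc i)" using v_in v_in' by auto
      with neq that 3 show ?thesis
        using e_far[of j "Suc i"] e_far[of i j] by (cases "j < i") auto
    qed
  qed
  have v_neq: "v i \<noteq> v j" if "i < j" "j \<le> n" for i j
  proof
    assume eq: "v i = v j"
    have "v i \<in> e j" using v_in[of j] that eq by simp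
    then have j: "j = Suc i" using v_only[of i j] that by auto
    show False
    proof (cases "i = 0")
      case True
      \<comment> \<open>For \<open>n = 1\<close> both ends lie on the same edge and only
        \<open>w \<noteq> w'\<close> separates them. Otherwise the common vertex would lie on
        \<open>e 2\<close>, impossible for \<open>v 0\<close>.\<close>
      show ?thesis
      proof (cases "n = 1")
        case True
        with \<open>i = 0\<close> j eq v0 vn ww' show ?thesis by simp
      next
        case False
        with True j have "v i \<in> e (Suc j)" using v_in'[of j] n eq by simp
        then show ?thesis using v_only[of i "Suc j"] False True j n by simp
      qed
    next
      case False
      then have "v j \<in> e i" using v_in[of i] that eq by simp
      then show ?thesis using v_only[of j i] False that by simp
    qed
  qed
  have v_inj: "i = j" if "i \<le> n" "j \<le> n" "v i = v j" for i j
    using that v_neq[of i j] v_neq[of j i] by (cases i j rule: linorder_cases) auto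
  have e_e: "e i \<inter> e j \<subseteq> {v i}" if "1 \<le> i" "i < j" "j \<le> n" for i j
    using that c[of i] vc[of i] e_far[of i j] by (cases "j = Suc i") auto
  \<comment> \<open>This replaces the unordered attaching set by the indices \<open>0\<close> to
    \<open>n\<close>, which number the teeth.\<close>
  have AV: "A = v ` {..n}"
  proof (intro equalityI subsetI)
    fix u assume "u \<in> A"
    then consider "u = w" | "u = w'" | "u \<in> joint_vertices n e" by (auto simp: A)
    then show "u \<in> v ` {..n}"
    proof cases
      case 3
      then obtain i j where "1 \<le> i" "i < j" "j \<le> n" "u \<in> e i \<inter> e j"
        unfolding joint_vertices_def by (auto simp: neq_iff)
      then show ?thesis using e_e[of i j] by auto
    qed (use v0 vn in auto)
  next
    fix u assume "u \<in> v ` {..n}"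
    then obtain i where i: "i \<le> n" "u = v i" by auto
    then consider "i = 0" | "i = n" | "1 \<le> i" "i < n" by linarith
    then show "u \<in> A"
    proof cases
      case 3
      then have "u \<in> joint_vertices n e"
        unfolding joint_vertices_def mem_Collect_eq using v_in[of i] v_in'[of i] i
        by (intro bexI[of _ i] bexI[of _ "Suc i"]) simp_all
      then show ?thesis by (simp add: A)
    qed (simp_all add: i(2) v0 vn A)
  qed
  have verts_P: "verts P = (\<Union>i\<in>{1..n}. e i)" and edges_P: "edges P = e ` {1..n}"
    by (auto simp: P linear_hyperpath_def)
  have f_fin: "finite (f (v i))" and f_card: "card (f (v i)) = l"
    and f_P: "f (v i) \<inter> verts P = {v i}" if "i \<le> n" for i
    using that f by (auto simp: AV)
  have ff': "f (v i) \<inter> f (v j) = {}" if "i \<le> n" "j \<le> n" "i \<noteq> j" for i j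
    using that ff v_inj[of i j] by (auto simp: AV)
  have v_P: "v i \<in> verts P" if "i \<le> n" for i
    using f_P[OF that] by auto
  define p where "p i = e (Suc i) - {v i, v (Suc i)}" for i
  define g where "g i = f (v i) - {v i}" for i
  have p_P: "p i \<subseteq> verts P" if "i < n" for i
    using that by (auto simp: p_def verts_P)
  have g_P: "g i \<inter> verts P = {}" if "i \<le> n" for i
    using f_P[OF that] by (auto simp: g_def)
  have e_eq: "e (Suc i) = insert (v i) (insert (v (Suc i)) (p i))" if "i < n" for i
    using that v_in[of "Suc i"] v_in'[of i] by (auto simp: p_def)
  have v_f: "v i \<in> f (v i)" if "i \<le> n" for i
    using f_P[OF that] by auto
  have f_eq: "f (v i) = insert (v i) (g i)" if "i \<le> n" for i
    using v_f[OF that] by (auto simp: g_def)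
  \<comment> \<open>The bound on \<open>l\<close> required by the locale follows from two distinct
    attaching vertices on \<open>e 1\<close>.\<close>
  have "card {v 0, v 1} \<le> card (e 1)"
    using n v_in[of 1] v_in'[of 0] e_fin(1)[of 1] by (intro card_mono) auto
  then have l: "l \<ge> 2"
    using n v_neq[of 0 1] e_fin(2)[of 1] by simp
  have p_p: "p i \<inter> p j = {}" if "i < j" "j < n" for i j
    using that e_e[of "Suc i" "Suc j"] by (auto simp: p_def)
  interpret comb n l v p g
  proof
    show "v i \<notin> p j" if "i \<le> n" "j < n" for i j
      using that v_only[of i "Suc j"] by (auto simp: p_def)
    show "v i \<notin> g j" if "i \<le> n" "j \<le> n" for i j
      using that v_P g_P by blast
    show "p i \<inter> p j = {}" if "i < n" "j < n" "i \<noteq> j" for i j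
      using that p_p[of i j] p_p[of j i] by (cases i j rule: linorder_cases) auto
    show "g i \<inter> g j = {}" if "i \<le> n" "j \<le> n" "i \<noteq> j" for i j
      using ff'[OF that] by (auto simp: g_def)
    show "p i \<inter> g j = {}" if "i < n" "j \<le> n" for i j
      using that p_P g_P by blast
    show "finite (p i)" if "i < n" for i
      using that e_fin(1)[of "Suc i"] by (simp add: p_def)
    show "card (p i) = l - 2" if "i < n" for i
      using that e_fin[of "Suc i"] v_in[of "Suc i"] v_in'[of i] v_neq[of i "Suc i"]
      by (simp add: p_def card_Diff_subset)
    show "finite (g i)" "card (g i) = l - 1" if "i \<le> n" for i
      using f_fin[OF that] f_card[OF that] v_f[OF that] by (simp_all add: g_def)
  qed (fact l, fact v_inj)
  have pe: "e (Suc i) = path_edge i" if "i < n" for i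
    using e_eq[OF that] by (simp add: path_edge_def)
  have te: "f (v i) = tooth i" if "i \<le> n" for i
    using f_eq[OF that] by (simp add: tooth_def)
  \<comment> \<open>Path edges are numbered from 1 in the hypercomb and from 0 in the
    locale.\<close>
  have Suc_img: "{1..n} = Suc ` {..<n}"
    by (simp add: image_Suc_lessThan)
  have edges': "edges H = path_edge ` {..<n} \<union> tooth ` {..n}"
    unfolding edges edges_P AV Suc_img image_image using pe te by (auto simp: image_iff)
  have verts': "verts H = V n"
    unfolding verts verts_P AV Suc_img V_def using pe te by auto
  have "{S. indep_set H S} = I n"
    by (simp add: indep_set_def I_def edges' verts' ball_Un lessThan_def atMost_def)
  then show ?thesis
    using indep_poly_eq_size_gf[of H] size_gf_I finite_V[of n] verts' by simp
qed

section \<open>The initial value and the three-term recurrence\<close>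

theorem theorem1p3:
  fixes l :: nat and H :: "nat \<Rightarrow> 'a hypergraph" and C :: "nat \<Rightarrow> int poly"
  assumes "l \<ge> 3"
    and "\<And>n. n \<ge> 1 \<Longrightarrow> is_hypercomb n l (H n)"
    and "\<And>n. n \<ge> 1 \<Longrightarrow> C n = indep_poly (H n)"
    and "C 0 = [:1, int l:]"
  shows "C 1 = [:1, 3 * int l - 2,
                 2 * (int l - 1) * (int l - 2) + (int l - 1)^2 + 2 * (int l - 1),
                 (int l - 1)^2 * (int l - 2):]
    \<and> (\<forall>n\<ge>2. C n = [:1, int l - 1:] * ([:1, int l - 2:] * C (n - 1) + [:0, 1:] * C (n - 2)))"
proof -
  \<comment> \<open>The prescribed \<open>C 0\<close> fits the same formula, since
    \<open>1 + (l - 1) x\<close> and \<open>x\<close> add up to \<open>1 + l x\<close>; thus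
    \<open>n = 2\<close> needs no separate treatment.\<close>
  have C: "C n = free_poly (int l) n + occ_poly (int l) n" for n
    using assms indep_poly_hypercomb[of n l "H n"] by (cases "n = 0") auto
  have "C 1 = [:1, 3 * int l - 2,
                 2 * (int l - 1) * (int l - 2) + (int l - 1)^2 + 2 * (int l - 1),
                 (int l - 1)^2 * (int l - 2):]"
    by (simp add: C algebra_simps power2_eq_square)
  moreover have "C n = [:1, int l - 1:] * ([:1, int l - 2:] * C (n - 1) + [:0, 1:] * C (n - 2))"
    if n: "n \<ge> 2" for n
  proof -
    obtain m where m: "n = Suc (Suc m)" using n by (metis Suc_le_D numeral_2_eq_2 Suc_le_mono)
    \<comment> \<open>Here \<open>a\<close> and \<open>b\<close> stand for the two polynomials at
      index \<open>m\<close>; each side is the recursion unfolded down to them. The identity holds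
      for arbitrary \<open>q\<close>, \<open>r\<close> and \<open>x\<close>.\<close>
    have "(q * (r * (q * (r * a + b)) + x * a) + x * (q * (r * a + b))) =
        q * (r * (q * (r * a + b) + x * a) + x * (a + b))" for q r a b x :: "int poly"
      by (simp add: algebra_simps)
    then show ?thesis
      unfolding C m by (simp only: free_poly.simps occ_poly.simps diff_Suc_Suc diff_Suc_1 minus_nat.diff_0 numeral_2_eq_2)
  qed
  ultimately show ?thesis by blast
qed

end
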